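(* Let $G$ be a torsion-free abelian group, let $R=\bigoplus_{i\in G}R_i$ be a $G$-graded commutative ring, let $I$ be a graded radical ideal of $R$, and let $J$ be an arbitrary (not necessarily graded) ideal of $R$. Then the colon ideal $I:_RJ=\{r\in R: rJ\subseteq I\}$ is a graded ideal of $R$.
   Context: Rings have an identity. A $G$-graded ring is a ring $R$ with a decomposition $R=\bigoplus_{n\in G}R_n$ of its additive group into subgroups with $R_mR_n\subseteq R_{m+n}$ for all $m,n\in G$. An ideal $I$ is graded if for every $f=\sum_n r_n\in I$ with $r_n\in R_n$, all $r_n$ lie in $I$. A radical ideal is an ideal $I$ with $\sqrt I=I$. *)

theory Defs
  imports "HOL-Algebra.Algebra"
begin

text \<open>The grading group is written multiplicatively, following \<^locale>\<open>comm_group\<close>;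
  only the degrees in its carrier matter.\<close>

definition torsion_free :: "('g, 'm) monoid_scheme \<Rightarrow> bool" where
  "torsion_free G \<longleftrightarrow>
     (\<forall>g \<in> carrier G. \<forall>n::nat. 0 < n \<longrightarrow> g [^]\<^bsub>G\<^esub> n = \<one>\<^bsub>G\<^esub> \<longrightarrow> g = \<one>\<^bsub>G\<^esub>)"

definition support :: "('g, 'm) monoid_scheme \<Rightarrow> ('r, 'n) ring_scheme \<Rightarrow> ('g \<Rightarrow> 'r) \<Rightarrow> 'g set" where
  "support G R f = {g \<in> carrier G. f g \<noteq> \<zero>\<^bsub>R\<^esub>}"

text \<open>The external direct sum of the family \<open>A\<close>: finitely supported choices of one element from
  each \<open>A g\<close>. Being extensional, such a choice is determined by its values on \<open>carrier G\<close>.\<close>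

definition direct_sum ::
  "('g, 'm) monoid_scheme \<Rightarrow> ('r, 'n) ring_scheme \<Rightarrow> ('g \<Rightarrow> 'r set) \<Rightarrow> ('g \<Rightarrow> 'r) set" where
  "direct_sum G R A = {f \<in> (\<Pi>\<^sub>E g \<in> carrier G. A g). finite (support G R f)}"

text \<open>\<^const>\<open>finsum\<close> over an infinite set is zero by convention, so the sum is taken over the
  support rather than over all of \<open>carrier G\<close>.\<close>

definition family_sum :: "('g, 'm) monoid_scheme \<Rightarrow> ('r, 'n) ring_scheme \<Rightarrow> ('g \<Rightarrow> 'r) \<Rightarrow> 'r" where
  "family_sum G R f = (\<Oplus>\<^bsub>R\<^esub>g \<in> support G R f. f g)"

locale graded_ring = G: comm_group G + R: ring R
  for G :: "('g, 'm) monoid_scheme" and R :: "('r, 'n) ring_scheme" +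
  fixes A :: "'g \<Rightarrow> 'r set"
  assumes component: "g \<in> carrier G \<Longrightarrow> additive_subgroup (A g) R"
    and decomposition: "x \<in> carrier R \<Longrightarrow> \<exists>!f. f \<in> direct_sum G R A \<and> family_sum G R f = x"
    and mult_component: "\<lbrakk>g \<in> carrier G; h \<in> carrier G; x \<in> A g; y \<in> A h\<rbrakk>
      \<Longrightarrow> x \<otimes>\<^bsub>R\<^esub> y \<in> A (g \<otimes>\<^bsub>G\<^esub> h)"

definition graded_ideal ::
  "('g, 'm) monoid_scheme \<Rightarrow> ('r, 'n) ring_scheme \<Rightarrow> ('g \<Rightarrow> 'r set) \<Rightarrow> 'r set \<Rightarrow> bool" where
  "graded_ideal G R A I \<longleftrightarrow> ideal I R \<and>
     (\<forall>f \<in> direct_sum G R A. family_sum G R f \<in> I \<longrightarrow> (\<forall>g \<in> carrier G. f g \<in> I))"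

definition radical :: "('r, 'n) ring_scheme \<Rightarrow> 'r set \<Rightarrow> 'r set" where
  "radical R I = {r \<in> carrier R. \<exists>n::nat. 0 < n \<and> r [^]\<^bsub>R\<^esub> n \<in> I}"

definition radical_ideal :: "('r, 'n) ring_scheme \<Rightarrow> 'r set \<Rightarrow> bool" where
  "radical_ideal R I \<longleftrightarrow> ideal I R \<and> radical R I = I"

definition colon_ideal :: "('r, 'n) ring_scheme \<Rightarrow> 'r set \<Rightarrow> 'r set \<Rightarrow> 'r set" where
  "colon_ideal R I J = {r \<in> carrier R. \<forall>j \<in> J. r \<otimes>\<^bsub>R\<^esub> j \<in> I}"

end

theory Submission
  imports Defs
begin

text \<open>A torsion-free abelian group carries a translation-invariant total order (Levi). Let
  \<open>r = \<Sum> r\<^sub>g\<close> and \<open>s = \<Sum> s\<^sub>h\<close> satisfy \<open>r s \<in> I\<close>, and let \<open>k\<close> be the least degree \<open>g h\<close> of a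
  product \<open>r\<^sub>g s\<^sub>h \<notin> I\<close>. The component of \<open>r s\<close> of degree \<open>k\<close> lies in \<open>I\<close>; multiply it by
  \<open>r\<^sub>g s\<^sub>h\<close>. Each term \<open>r\<^sub>g' s\<^sub>h'\<close> other than \<open>r\<^sub>g s\<^sub>h\<close> contributes \<open>(r\<^sub>g s\<^sub>h') (r\<^sub>g' s\<^sub>h)\<close>, and
  one of the two factors has degree below \<open>k\<close>, hence lies in \<open>I\<close>. So \<open>(r\<^sub>g s\<^sub>h)\<^sup>2 \<in> I\<close>, and
  \<open>r\<^sub>g s\<^sub>h \<in> I\<close> as \<open>I\<close> is radical. Thus \<open>r s \<in> I\<close> forces every \<open>r\<^sub>g s\<^sub>h\<close>, and so every
  \<open>r\<^sub>g s\<close>, into \<open>I\<close>.\<close>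

section \<open>Orderability of torsion-free abelian groups\<close>

text \<open>These are the elements above the identity for a translation-invariant partial order,
  where \<open>x \<le> y\<close> means that \<open>y \<otimes> inv x\<close> lies in
  \<open>P\<close>. The last clause is antisymmetry. Totality is left out so that Zorn's lemma can
  range over all partial orders.\<close>

definition positive_cone :: "('g, 'm) monoid_scheme \<Rightarrow> 'g set \<Rightarrow> bool" where
  "positive_cone G P \<longleftrightarrow> P \<subseteq> carrier G \<and> \<one>\<^bsub>G\<^esub> \<in> P \<and>
     (\<forall>x\<in>P. \<forall>y\<in>P. x \<otimes>\<^bsub>G\<^esub> y \<in> P) \<and> (\<forall>x\<in>P. \<forall>y\<in>P. x \<otimes>\<^bsub>G\<^esub> y = \<one>\<^bsub>G\<^esub> \<longrightarrow> x = \<one>\<^bsub>G\<^esub>)"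

context comm_group
begin

lemma positive_cone_pow_closed:
  fixes n :: nat
  assumes "positive_cone G P" "x \<in> P"
  shows "x [^] n \<in> P"
  using assms by (induction n) (auto simp: positive_cone_def)

text \<open>Adjoining \<open>x\<close> can only break antisymmetry. If two elements with exponents
  \<open>m\<close> and \<open>n\<close> are mutually inverse, then
  \<open>inv (x [^] (m + n))\<close> lies in \<open>P\<close>; this forces \<open>m + n = 0\<close>
  and reduces the claim to \<open>P\<close> itself.\<close>

lemma positive_cone_extend:
  assumes P: "positive_cone G P" and x: "x \<in> carrier G"
    and no_inv: "\<And>n::nat. 0 < n \<Longrightarrow> inv (x [^] n) \<notin> P"
  shows "positive_cone G {p \<otimes> x [^] n |p n::nat. p \<in> P}" (is "positive_cone G ?Q")
proof -
  have PG: "P \<subseteq> carrier G" and one: "\<one> \<in> P"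
    and mult: "\<And>a b. a \<in> P \<Longrightarrow> b \<in> P \<Longrightarrow> a \<otimes> b \<in> P"
    and anti: "\<And>a b. a \<in> P \<Longrightarrow> b \<in> P \<Longrightarrow> a \<otimes> b = \<one> \<Longrightarrow> a = \<one>"
    using P by (auto simp: positive_cone_def)
  have prod: "(p \<otimes> x [^] m) \<otimes> (q \<otimes> x [^] n) = (p \<otimes> q) \<otimes> x [^] (m + n)"
    if "p \<in> P" "q \<in> P" for p q and m n :: nat
    using that PG x by (simp add: nat_pow_mult [symmetric] m_ac subset_iff)
  have "a \<otimes> b \<in> ?Q" if "a \<in> ?Q" "b \<in> ?Q" for a b
    using that prod mult by fastforce
  moreover have "a = \<one>" if "a \<in> ?Q" "b \<in> ?Q" and ab: "a \<otimes> b = \<one>" for a b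
  proof -
    obtain p m where p: "p \<in> P" "a = p \<otimes> x [^] (m::nat)" using \<open>a \<in> ?Q\<close> by auto
    obtain q n where q: "q \<in> P" "b = q \<otimes> x [^] (n::nat)" using \<open>b \<in> ?Q\<close> by auto
    have eq: "(p \<otimes> q) \<otimes> x [^] (m + n) = \<one>"
      using ab prod p q by simp
    have "inv (x [^] (m + n)) = p \<otimes> q"
      using eq x mult[OF p(1) q(1)] PG by (intro inv_equality) auto
    then have "m + n = 0"
      using no_inv mult[OF p(1) q(1)] by (metis gr0I)
    then show ?thesis
      using eq anti[OF p(1) q(1)] p q PG by (auto simp: subset_iff)
  qed
  moreover have "\<one> \<in> ?Q"
    using one by (force intro!: exI[of _ "\<one>"] exI[of _ "0::nat"])
  moreover have "?Q \<subseteq> carrier G"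
    using PG x by auto
  ultimately show ?thesis
    unfolding positive_cone_def by blast
qed

text \<open>Take a maximal cone. If it omits both \<open>x\<close> and \<open>inv x\<close>, neither
  can be adjoined, so it contains a negative and a positive power of \<open>x\<close>. Passing to a
  common exponent yields a nontrivial relation \<open>x [^] (m * n) = \<one>\<close>, and
  torsion-freeness gives \<open>x = \<one>\<close>, which is in the cone.\<close>

lemma ex_total_positive_cone:
  assumes tf: "torsion_free G"
  shows "\<exists>P. positive_cone G P \<and> (\<forall>x\<in>carrier G. x \<in> P \<or> inv x \<in> P)"
proof -
  have "\<exists>P\<in>Collect (positive_cone G). \<forall>Q\<in>Collect (positive_cone G). P \<subseteq> Q \<longrightarrow> Q = P"
  proof (rule subset_Zorn_nonempty)
    show "Collect (positive_cone G) \<noteq> {}"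
      by (auto simp: positive_cone_def intro!: exI[of _ "{\<one>}"])
  next
    fix C assume "C \<noteq> {}" and C: "subset.chain (Collect (positive_cone G)) C"
    have cone: "positive_cone G P" if "P \<in> C" for P
      using C that by (auto simp: subset.chain_def)
    \<comment> \<open>The cone axioms involve at most two elements at a time, so in the union of a
      chain they can be checked inside a single member.\<close>
    have common: "\<exists>P\<in>C. x \<in> P \<and> y \<in> P" if xy: "x \<in> \<Union>C" "y \<in> \<Union>C" for x y
    proof -
      obtain U V where UV: "U \<in> C" "x \<in> U" "V \<in> C" "y \<in> V" using xy by blast
      then have "U \<subseteq> V \<or> V \<subseteq> U" using C by (simp add: subset_chain_def)
      with UV show ?thesis by blast
    qed
    have mult: "x \<otimes> y \<in> \<Union>C" if "x \<in> \<Union>C" "y \<in> \<Union>C" for x y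
      using common[OF that] cone unfolding positive_cone_def by blast
    have anti: "x = \<one>" if "x \<in> \<Union>C" "y \<in> \<Union>C" "x \<otimes> y = \<one>" for x y
      using common[OF that(1,2)] that(3) cone unfolding positive_cone_def by blast
    have "\<one> \<in> \<Union>C" "\<Union>C \<subseteq> carrier G"
      using \<open>C \<noteq> {}\<close> cone unfolding positive_cone_def by blast+
    then show "\<Union>C \<in> Collect (positive_cone G)"
      using mult anti unfolding positive_cone_def by blast
  qed
  then obtain P where P: "positive_cone G P"
    and max: "\<And>Q. positive_cone G Q \<Longrightarrow> P \<subseteq> Q \<Longrightarrow> Q = P"
    by auto
  have PG: "P \<subseteq> carrier G" and one: "\<one> \<in> P"
    using P by (auto simp: positive_cone_def)
  have maximal: "\<exists>n::nat. 0 < n \<and> inv (x [^] n) \<in> P" if x: "x \<in> carrier G" "x \<notin> P" for x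
  proof (rule ccontr)
    let ?Q = "{p \<otimes> x [^] n |p n::nat. p \<in> P}"
    assume "\<not> ?thesis"
    then have "positive_cone G ?Q"
      using positive_cone_extend[OF P x(1)] by blast
    moreover have "P \<subseteq> ?Q"
      using PG by (force intro!: exI[of _ "0::nat"])
    ultimately have "?Q = P"
      by (rule max)
    moreover have "\<one> \<otimes> x [^] (1::nat) \<in> ?Q"
      using one by blast
    ultimately show False
      using x by simp
  qed
  have "x \<in> P \<or> inv x \<in> P" if x: "x \<in> carrier G" for x
  proof (rule ccontr)
    assume *: "\<not> ?thesis"
    obtain m :: nat where m: "0 < m" "inv (x [^] m) \<in> P"
      using maximal[of x] * x by blast
    obtain n :: nat where n: "0 < n" "x [^] n \<in> P"
      using maximal[of "inv x"] * x by (auto simp: nat_pow_inv)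
    have "(x [^] n) [^] m \<in> P" "(inv (x [^] m)) [^] n \<in> P"
      using positive_cone_pow_closed[OF P] m n by auto
    moreover have "(x [^] n) [^] m = x [^] (m * n)" "(inv (x [^] m)) [^] n = inv (x [^] (m * n))"
      using x by (simp_all add: nat_pow_pow nat_pow_inv mult.commute)
    ultimately have "x [^] (m * n) = \<one>"
      using P x unfolding positive_cone_def by (metis nat_pow_closed r_inv)
    then have "x = \<one>"
      using tf x m n unfolding torsion_free_def by (metis nat_0_less_mult_iff)
    with * one show False by simp
  qed
  with P show ?thesis by blast
qed

text \<open>The extreme element is the least element of \<open>K\<close> for an invariant order.\<close>

lemma ex_extreme_element:
  assumes tf: "torsion_free G" and K: "finite K" "K \<noteq> {}" "K \<subseteq> carrier G"
  shows "\<exists>k\<in>K. \<forall>a\<in>K. \<forall>b\<in>K. a \<otimes> b = k \<otimes> k \<longrightarrow> a = k"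
proof -
  obtain P where P: "positive_cone G P" and total: "\<And>x. x \<in> carrier G \<Longrightarrow> x \<in> P \<or> inv x \<in> P"
    using ex_total_positive_cone[OF tf] by blast
  have one: "\<one> \<in> P" and mult: "\<And>a b. a \<in> P \<Longrightarrow> b \<in> P \<Longrightarrow> a \<otimes> b \<in> P"
    and anti: "\<And>a b. a \<in> P \<Longrightarrow> b \<in> P \<Longrightarrow> a \<otimes> b = \<one> \<Longrightarrow> a = \<one>"
    using P by (auto simp: positive_cone_def)
  have "\<exists>k\<in>K. \<forall>x\<in>K. x \<otimes> inv k \<in> P"
    using K
  proof (induction K rule: finite_ne_induct)
    case (singleton x)
    then show ?case using one by simp
  next
    case (insert y K)
    then obtain k where k: "k \<in> K" "\<And>x. x \<in> K \<Longrightarrow> x \<otimes> inv k \<in> P" by auto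
    have G: "y \<in> carrier G" "k \<in> carrier G" "K \<subseteq> carrier G" using insert k by auto
    show ?case
    \<comment> \<open>Compare the new element \<open>y\<close> with the old minimum
      \<open>k\<close>: by totality, either \<open>k\<close> stays least or \<open>y\<close>
      replaces it.\<close>
    proof (cases "y \<otimes> inv k \<in> P")
      case True
      with k show ?thesis by auto
    next
      case False
      then have ky: "k \<otimes> inv y \<in> P"
        using total[of "y \<otimes> inv k"] G by (simp add: inv_mult_group)
      have "x \<otimes> inv y \<in> P" if "x \<in> K" for x
      proof -
        have "(x \<otimes> inv k) \<otimes> (k \<otimes> inv y) = x \<otimes> inv y"
          using G that by (auto simp: m_assoc subset_iff m_assoc [symmetric, of "inv k" k])
        with mult[OF k(2)[OF that] ky] show ?thesis by simp
      qed
      with one G show ?thesis by auto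
    qed
  qed
  then obtain k where k: "k \<in> K" "\<And>x. x \<in> K \<Longrightarrow> x \<otimes> inv k \<in> P" by blast
  have "a = k" if ab: "a \<in> K" "b \<in> K" "a \<otimes> b = k \<otimes> k" for a b
  proof -
    have G: "a \<in> carrier G" "b \<in> carrier G" "k \<in> carrier G" using ab k K by auto
    \<comment> \<open>Both factors lie in \<open>P\<close> because \<open>k\<close> is least, and
      their product is the identity, so antisymmetry applies.\<close>
    have "(a \<otimes> inv k) \<otimes> (b \<otimes> inv k) = (a \<otimes> b) \<otimes> inv (k \<otimes> k)"
      using G by (simp add: inv_mult_group m_ac)
    also have "\<dots> = \<one>" using G ab by simp
    finally have "a \<otimes> inv k = \<one>" using anti k ab by blast
    then show ?thesis using G by (metis inv_equality inv_closed inv_inv)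
  qed
  with k show ?thesis by blast
qed

end

section \<open>Sums and ideals\<close>

lemma (in abelian_monoid) finsum_fibres:
  assumes S: "finite S" and f: "f \<in> S \<rightarrow> carrier G"
  shows "(\<Oplus>k\<in>q ` S. \<Oplus>x\<in>{x\<in>S. q x = k}. f x) = (\<Oplus>x\<in>S. f x)"
proof -
  have "(\<Oplus>x\<in>(\<Union>k\<in>q ` S. {x\<in>S. q x = k}). f x) = (\<Oplus>k\<in>q ` S. \<Oplus>x\<in>{x\<in>S. q x = k}. f x)"
    by (rule add.finprod_UN_disjoint) (use S f in \<open>auto simp: pairwise_def disjnt_def\<close>)
  moreover have "(\<Union>k\<in>q ` S. {x\<in>S. q x = k}) = S" by auto
  ultimately show ?thesis by simp
qed

lemma (in semiring) finsum_times_finsum: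
  assumes S: "finite S" and T: "finite T"
    and f: "f \<in> S \<rightarrow> carrier R" and g: "g \<in> T \<rightarrow> carrier R"
  shows "(\<Oplus>x\<in>S. f x) \<otimes> (\<Oplus>y\<in>T. g y) = (\<Oplus>p\<in>S \<times> T. f (fst p) \<otimes> g (snd p))"
\<comment> \<open>For empty \<open>T\<close> the first projection of \<open>S \<times> T\<close> is
  empty rather than \<open>S\<close>, so grouping pairs by first coordinate requires
  \<open>T\<close> nonempty.\<close>
proof (cases "T = {}")
  case True
  with S f show ?thesis by simp
next
  case False
  have fibre: "(\<Oplus>p\<in>{p\<in>S \<times> T. fst p = x}. f (fst p) \<otimes> g (snd p)) = f x \<otimes> (\<Oplus>y\<in>T. g y)"
    if "x \<in> S" for x
  proof -
    have "{p\<in>S \<times> T. fst p = x} = Pair x ` T" using that by auto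
    moreover have "(\<Oplus>p\<in>Pair x ` T. f (fst p) \<otimes> g (snd p)) = (\<Oplus>y\<in>T. f x \<otimes> g y)"
      using that f g by (subst add.finprod_reindex) (auto simp: inj_on_def Pi_iff)
    ultimately show ?thesis
      using that f g T by (simp add: finsum_rdistr Pi_iff)
  qed
  have "(\<Oplus>p\<in>S \<times> T. f (fst p) \<otimes> g (snd p))
      = (\<Oplus>x\<in>fst ` (S \<times> T). \<Oplus>p\<in>{p\<in>S \<times> T. fst p = x}. f (fst p) \<otimes> g (snd p))"
    by (rule finsum_fibres [symmetric]) (use S T f g in \<open>auto simp: Pi_iff\<close>)
  also have "\<dots> = (\<Oplus>x\<in>S. f x \<otimes> (\<Oplus>y\<in>T. g y))"
    using False f g by (intro add.finprod_cong') (auto simp: fibre)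
  also have "\<dots> = (\<Oplus>x\<in>S. f x) \<otimes> (\<Oplus>y\<in>T. g y)"
    by (rule finsum_ldistr [symmetric]) (use S f g in auto)
  finally show ?thesis by simp
qed

lemma (in additive_subgroup) subgroup_finsum_closed:
  assumes "abelian_monoid G" "finite S" "\<And>x. x \<in> S \<Longrightarrow> f x \<in> H"
  shows "(\<Oplus>x\<in>S. f x) \<in> H"
proof -
  interpret abelian_monoid G by fact
  show ?thesis
    using assms(2,3)
    by (induction S rule: finite_induct) (auto simp: a_Hcarr Pi_iff)
qed

lemma (in cring) colon_ideal_is_ideal:
  assumes I: "ideal I R" and J: "J \<subseteq> carrier R"
  shows "ideal (colon_ideal R I J) R"
proof -
  interpret I: ideal I R by fact
  have J': "j \<in> carrier R" if "j \<in> J" for j using that J by blast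
  have "inv\<^bsub>add_monoid R\<^esub> a \<in> colon_ideal R I J" if "a \<in> colon_ideal R I J" for a
    using that J' by (auto simp: colon_ideal_def l_minus simp flip: a_inv_def)
  then have "subgroup (colon_ideal R I J) (add_monoid R)"
    using J' by unfold_locales (auto simp: colon_ideal_def l_distr)
  moreover have "x \<otimes> a \<in> colon_ideal R I J" if "a \<in> colon_ideal R I J" "x \<in> carrier R" for a x
    using that J' I.I_l_closed by (auto simp: colon_ideal_def m_assoc)
  moreover have "a \<otimes> x \<in> colon_ideal R I J" if "a \<in> colon_ideal R I J" "x \<in> carrier R" for a x
    using calculation(2)[OF that] that m_comm by (auto simp: colon_ideal_def)
  ultimately show ?thesis
    using ring_axioms by (intro idealI)
qed

section \<open>Products of homogeneous components\<close>

context graded_ring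
begin

lemma component_closed: "g \<in> carrier G \<Longrightarrow> x \<in> A g \<Longrightarrow> x \<in> carrier R"
  using additive_subgroup.a_Hcarr[OF component] .

lemma direct_sum_component: "f \<in> direct_sum G R A \<Longrightarrow> g \<in> carrier G \<Longrightarrow> f g \<in> A g"
  by (auto simp: direct_sum_def)

lemma direct_sum_closed: "f \<in> direct_sum G R A \<Longrightarrow> g \<in> carrier G \<Longrightarrow> f g \<in> carrier R"
  using component_closed direct_sum_component by blast

text \<open>Allows summation over a convenient finite set of degrees when the exact support is
  unknown, as happens when terms of equal degree cancel.\<close>

lemma family_sum_eq_finsum:
  assumes "f \<in> direct_sum G R A" "finite S" "support G R f \<subseteq> S" "S \<subseteq> carrier G"
  shows "family_sum G R f = (\<Oplus>\<^bsub>R\<^esub>g\<in>S. f g)"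
  unfolding family_sum_def
  by (rule R.add.finprod_mono_neutral_cong_left)
     (use assms direct_sum_closed in \<open>auto simp: support_def\<close>)

text \<open>The sum in the conclusion is the component of degree \<open>k\<close> of the product.
  Grouping the products of components by degree gives a member of \<open>direct_sum\<close> to which
  the gradedness of \<open>I\<close> applies.\<close>

lemma product_component_mem_graded_ideal:
  assumes I: "graded_ideal G R A I"
    and r: "r \<in> direct_sum G R A" and s: "s \<in> direct_sum G R A"
    and rs: "family_sum G R r \<otimes>\<^bsub>R\<^esub> family_sum G R s \<in> I"
    and k: "k \<in> carrier G"
  shows "(\<Oplus>\<^bsub>R\<^esub>p\<in>{p \<in> support G R r \<times> support G R s. fst p \<otimes>\<^bsub>G\<^esub> snd p = k}.
           r (fst p) \<otimes>\<^bsub>R\<^esub> s (snd p)) \<in> I"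
proof -
  define S where "S = support G R r \<times> support G R s"
  define q where "q = (\<lambda>p. fst p \<otimes>\<^bsub>G\<^esub> snd p)"
  define t where "t = (\<lambda>p. r (fst p) \<otimes>\<^bsub>R\<^esub> s (snd p))"
  define c where "c = (\<lambda>k\<in>carrier G. \<Oplus>\<^bsub>R\<^esub>p\<in>{p\<in>S. q p = k}. t p)"
  have fin: "finite (support G R r)" "finite (support G R s)" "finite S"
    using r s by (auto simp: direct_sum_def S_def)
  have q: "q p \<in> carrier G" and t: "t p \<in> A (q p)" and tR: "t p \<in> carrier R" if "p \<in> S" for p
    using that r s mult_component direct_sum_component direct_sum_closed
    by (auto simp: S_def q_def t_def support_def)
  have cA: "c g \<in> A g" if "g \<in> carrier G" for g
  proof -
    have "(\<Oplus>\<^bsub>R\<^esub>p\<in>{p\<in>S. q p = g}. t p) \<in> A g"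
      by (rule additive_subgroup.subgroup_finsum_closed[OF component[OF that] R.abelian_monoid_axioms])
         (use fin t in auto)
    with that show ?thesis by (simp add: c_def)
  qed
  \<comment> \<open>Equality may fail through cancellation; the inclusion suffices for finiteness
    and for rewriting \<open>family_sum\<close>.\<close>
  have supp: "support G R c \<subseteq> q ` S"
  proof
    fix g assume "g \<in> support G R c"
    then have g: "g \<in> carrier G" "c g \<noteq> \<zero>\<^bsub>R\<^esub>" by (auto simp: support_def)
    have "{p\<in>S. q p = g} \<noteq> {}"
    proof
      assume "{p\<in>S. q p = g} = {}"
      then have "c g = \<zero>\<^bsub>R\<^esub>" using g(1) unfolding c_def by (simp only: restrict_apply' R.finsum_empty)
      with g show False by simp
    qed
    then show "g \<in> q ` S" by auto
  qed
  have c: "c \<in> direct_sum G R A"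
    using cA finite_subset[OF supp] fin by (auto simp: direct_sum_def c_def)
  have "family_sum G R c = (\<Oplus>\<^bsub>R\<^esub>g\<in>q ` S. c g)"
    using family_sum_eq_finsum[OF c _ supp] fin q by blast
  also have "\<dots> = (\<Oplus>\<^bsub>R\<^esub>g\<in>q ` S. \<Oplus>\<^bsub>R\<^esub>p\<in>{p\<in>S. q p = g}. t p)"
    by (rule R.add.finprod_cong') (use q tR in \<open>auto simp: c_def\<close>)
  also have "\<dots> = (\<Oplus>\<^bsub>R\<^esub>p\<in>S. t p)"
    by (rule R.finsum_fibres) (use fin tR in auto)
  also have "\<dots> = family_sum G R r \<otimes>\<^bsub>R\<^esub> family_sum G R s"
    unfolding family_sum_def S_def t_def
    by (rule R.finsum_times_finsum [symmetric])
       (use fin r s direct_sum_closed in \<open>auto simp: support_def\<close>)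
  finally have "c k \<in> I"
    using I rs c k by (auto simp: graded_ideal_def)
  then show ?thesis
    using k by (simp add: c_def S_def q_def t_def)
qed

lemma product_mem_radical_ideal:
  assumes tf: "torsion_free G" and R: "cring R"
    and I: "graded_ideal G R A I" and rad: "radical_ideal R I"
    and r: "r \<in> direct_sum G R A" and s: "s \<in> direct_sum G R A"
    and rs: "family_sum G R r \<otimes>\<^bsub>R\<^esub> family_sum G R s \<in> I"
    and g: "g \<in> support G R r" and h: "h \<in> support G R s"
  shows "r g \<otimes>\<^bsub>R\<^esub> s h \<in> I"
proof (rule ccontr)
  interpret R: cring R by fact
  interpret I: ideal I R using I by (simp add: graded_ideal_def)
  define S where "S = support G R r \<times> support G R s"
  define q where "q = (\<lambda>p. fst p \<otimes>\<^bsub>G\<^esub> snd p)"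
  define t where "t = (\<lambda>p. r (fst p) \<otimes>\<^bsub>R\<^esub> s (snd p))"
  define K where "K = q ` {p\<in>S. t p \<notin> I}"
  assume "r g \<otimes>\<^bsub>R\<^esub> s h \<notin> I"
  then have "K \<noteq> {}" using g h by (force simp: K_def S_def t_def)
  have finS: "finite S" using r s by (auto simp: S_def direct_sum_def)
  have SG: "fst p \<in> carrier G" "snd p \<in> carrier G" if "p \<in> S" for p
    using that by (auto simp: S_def support_def)
  have tR: "r (fst p) \<in> carrier R" "s (snd p) \<in> carrier R" "t p \<in> carrier R" if "p \<in> S" for p
    using SG[OF that] r s direct_sum_closed by (auto simp: t_def)
  have "finite K" using finS by (simp add: K_def)
  have "K \<subseteq> carrier G" using SG by (auto simp: K_def q_def)
  then obtain k where k: "k \<in> K"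
    and extreme: "\<And>a b. a \<in> K \<Longrightarrow> b \<in> K \<Longrightarrow> a \<otimes>\<^bsub>G\<^esub> b = k \<otimes>\<^bsub>G\<^esub> k \<Longrightarrow> a = k"
    using G.ex_extreme_element[OF tf \<open>finite K\<close> \<open>K \<noteq> {}\<close>] by blast
  obtain p where p: "p \<in> S" "t p \<notin> I" "q p = k" using k by (auto simp: K_def)
  define F where "F = {p'\<in>S. q p' = k}"
  have F: "finite F" "p \<in> F" "\<And>p'. p' \<in> F \<Longrightarrow> p' \<in> S" using finS p by (auto simp: F_def)
  have other: "t p \<otimes>\<^bsub>R\<^esub> t p' \<in> I" if p': "p' \<in> F - {p}" for p'
  proof -
    \<comment> \<open>Exchanging second coordinates preserves both the total degree and, by
      commutativity, the product \<open>t p \<otimes> t p'\<close>. Extremality of \<open>k\<close>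
      then prevents both new degrees from lying in \<open>K\<close>, so \<open>t u\<close> or
      \<open>t v\<close> is in \<open>I\<close>.\<close>
    define u v where "u = (fst p, snd p')" and "v = (fst p', snd p)"
    have S: "p' \<in> S" "u \<in> S" "v \<in> S" and qp': "q p' = k"
      using p' p by (auto simp: F_def S_def u_def v_def)
    have "q u \<otimes>\<^bsub>G\<^esub> q v = q p \<otimes>\<^bsub>G\<^esub> q p'"
      using SG p S by (auto simp: q_def u_def v_def G.m_ac)
    then have uv: "q u \<otimes>\<^bsub>G\<^esub> q v = k \<otimes>\<^bsub>G\<^esub> k" using p qp' by simp
    \<comment> \<open>Otherwise cancellation makes first the second coordinates and then the first
      coordinates of \<open>p\<close> and \<open>p'\<close> agree.\<close>
    have "q u \<noteq> k"
    proof
      assume "q u = k"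
      then have "snd p = snd p'"
        using p SG S by (metis G.l_cancel fst_conv snd_conv q_def u_def)
      moreover from this have "fst p = fst p'"
        using p qp' SG S by (metis G.r_cancel q_def)
      ultimately show False using p' by (auto simp: prod_eq_iff)
    qed
    then have "t u \<in> I \<or> t v \<in> I"
      using extreme[OF _ _ uv] S by (auto simp: K_def)
    moreover have "t p \<otimes>\<^bsub>R\<^esub> t p' = t u \<otimes>\<^bsub>R\<^esub> t v"
      using tR[OF p(1)] tR[OF S(1)] by (simp add: t_def u_def v_def R.m_ac)
    ultimately show ?thesis
      using tR[OF S(2)] tR[OF S(3)] I.I_l_closed I.I_r_closed by auto
  qed
  have "(\<Oplus>\<^bsub>R\<^esub>p'\<in>F. t p') \<in> I"
    using product_component_mem_graded_ideal[OF I r s rs, of k] k \<open>K \<subseteq> carrier G\<close>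
    unfolding F_def S_def q_def t_def by blast
  \<comment> \<open>Multiplying by \<open>t p\<close> leaves its square plus terms already known to
    lie in \<open>I\<close>.\<close>
  then have "t p \<otimes>\<^bsub>R\<^esub> (\<Oplus>\<^bsub>R\<^esub>p'\<in>F. t p') \<in> I"
    using tR p I.I_l_closed by blast
  moreover have "t p \<otimes>\<^bsub>R\<^esub> (\<Oplus>\<^bsub>R\<^esub>p'\<in>F. t p') = (\<Oplus>\<^bsub>R\<^esub>p'\<in>F. t p \<otimes>\<^bsub>R\<^esub> t p')"
    by (rule R.finsum_rdistr) (use F tR p in auto)
  moreover have "\<dots> = t p \<otimes>\<^bsub>R\<^esub> t p \<oplus>\<^bsub>R\<^esub> (\<Oplus>\<^bsub>R\<^esub>p'\<in>F - {p}. t p \<otimes>\<^bsub>R\<^esub> t p')"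
    using R.finsum_insert[of "F - {p}" p "\<lambda>p'. t p \<otimes>\<^bsub>R\<^esub> t p'"] F tR p
    by (auto simp: insert_absorb)
  moreover have rest: "(\<Oplus>\<^bsub>R\<^esub>p'\<in>F - {p}. t p \<otimes>\<^bsub>R\<^esub> t p') \<in> I"
    by (rule I.subgroup_finsum_closed[OF R.abelian_monoid_axioms]) (use F other in auto)
  ultimately have sum: "t p \<otimes>\<^bsub>R\<^esub> t p \<oplus>\<^bsub>R\<^esub> (\<Oplus>\<^bsub>R\<^esub>p'\<in>F - {p}. t p \<otimes>\<^bsub>R\<^esub> t p') \<in> I"
    by simp
  have "t p \<otimes>\<^bsub>R\<^esub> t p \<in> I"
  proof -
    let ?x = "t p \<otimes>\<^bsub>R\<^esub> t p" and ?y = "\<Oplus>\<^bsub>R\<^esub>p'\<in>F - {p}. t p \<otimes>\<^bsub>R\<^esub> t p'"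
    have "?x \<in> carrier R" "?y \<in> carrier R" using tR p rest I.a_Hcarr by auto
    then have "(?x \<oplus>\<^bsub>R\<^esub> ?y) \<oplus>\<^bsub>R\<^esub> (\<ominus>\<^bsub>R\<^esub> ?y) = ?x"
      by (simp add: R.a_assoc R.r_neg)
    then show ?thesis
      using I.a_closed[OF sum I.a_inv_closed[OF rest]] by simp
  qed
  then have "t p [^]\<^bsub>R\<^esub> (2::nat) \<in> I"
    using tR p by (simp add: numeral_2_eq_2)
  then have "t p \<in> radical R I"
    unfolding radical_def using tR p by (auto intro: exI[of _ 2])
  then show False
    using rad p by (simp add: radical_ideal_def)
qed

end

theorem theorem7p3:
  fixes G :: "('g, 'm) monoid_scheme"
    and R :: "('r, 'n) ring_scheme"
    and A :: "'g \<Rightarrow> 'r set"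
    and I J :: "'r set"
  assumes "graded_ring G R A"
    and "torsion_free G"
    and "cring R"
    and "graded_ideal G R A I"
    and "radical_ideal R I"
    and "ideal J R"
  shows "graded_ideal G R A (colon_ideal R I J)"
proof -
  interpret graded_ring G R A by fact
  interpret R: cring R by fact
  interpret I: ideal I R using assms(4) by (simp add: graded_ideal_def)
  interpret J: ideal J R by fact
  have "f g \<otimes>\<^bsub>R\<^esub> j \<in> I"
    if f: "f \<in> direct_sum G R A" and sum: "family_sum G R f \<in> colon_ideal R I J"
      and g: "g \<in> carrier G" and j: "j \<in> J" for f g j
  proof -
    have jR: "j \<in> carrier R" using j by (rule J.a_Hcarr)
    \<comment> \<open>\<open>J\<close> need not be graded, so the components of \<open>j\<close> may
      lie outside \<open>J\<close>. Only the product with all of \<open>j\<close> is known to be in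
      \<open>I\<close>, and the previous lemma splits it into products of components.\<close>
    then obtain s where s: "s \<in> direct_sum G R A" "family_sum G R s = j"
      using decomposition by blast
    have fg: "f g \<in> carrier R" using f g by (rule direct_sum_closed)
    have fs: "family_sum G R f \<otimes>\<^bsub>R\<^esub> family_sum G R s \<in> I"
      using sum j s by (simp add: colon_ideal_def)
    show ?thesis
    proof (cases "g \<in> support G R f")
      case True
      have fin: "finite (support G R s)" using s by (simp add: direct_sum_def)
      have "f g \<otimes>\<^bsub>R\<^esub> j = (\<Oplus>\<^bsub>R\<^esub>h\<in>support G R s. f g \<otimes>\<^bsub>R\<^esub> s h)"
        unfolding s(2) [symmetric] family_sum_def
        by (rule R.finsum_rdistr) (use fin fg s direct_sum_closed in \<open>auto simp: support_def\<close>)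
      also have "\<dots> \<in> I"
        by (rule I.subgroup_finsum_closed[OF R.abelian_monoid_axioms fin])
           (rule product_mem_radical_ideal[OF assms(2-5) f s(1) fs True])
      finally show ?thesis .
    next
      \<comment> \<open>Degrees outside the support are not covered by
        \<open>product_mem_radical_ideal\<close>, but there \<open>f g\<close> is zero.\<close>
      case False
      then show ?thesis using g jR by (simp add: support_def)
    qed
  qed
  then show ?thesis
    using R.colon_ideal_is_ideal[OF I.is_ideal J.a_subset] direct_sum_closed
    by (auto simp: graded_ideal_def colon_ideal_def)
qed

end
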